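(* Let $D\subset\mathbb R^2\cong\mathbb C$ be a bounded domain with $\mathcal{C}^2$ boundary, and suppose that $D$ is invariant under rotation of angle $2\pi/p$ for some integer $p\ge2$, i.e. $\{e^{2\pi i/p}x:x\in D\}=D$. Then, for all integers $m,n\ge1$, $$\mathbf N^{(1)}_{mn}(D)=0\ \text{ if } p \text{ does not divide } m+n,\qquad \mathbf N^{(2)}_{mn}(D)=0\ \text{ if } p\text{ does not divide } m-n .$$
   Context: Here $\lambda=\frac{\kappa+1}{2(\kappa-1)}$ with conductivity $\kappa>1$ (so $\lambda>1/2$) is fixed. For a bounded $\mathcal{C}^2$ domain $D$ with outward unit normal $\nu$, $\mathcal K_D^*[\phi](x)=\frac1{2\pi}\int_{\partial D}\frac{\langle x-y,\nu_x\rangle}{|x-y|^2}\phi(y)\,ds(y)$ on $L^2(\partial D)$; $\lambda I-\mathcal K_D^*$ is invertible on $L^2(\partial D)$. With $P_m(x)=(x_1+ix_2)^m$, the complex contracted generalized polarization tensors of $D$ are, for $m,n\ge1$, $$\mathbf N^{(1)}_{mn}(D)=\int_{\partial D}P_n(y)\,(\lambda I-\mathcal K_D^* )^{-1}[\langle\nu,\nabla P_m\rangle](y)\,ds(y),$$ $$\mathbf N^{(2)}_{mn}(D)=\int_{\partial D}P_n(y)\,(\lambda I-\mathcal K_D^* )^{-1}[\langle\nu,\nabla\overline{P_m}\rangle](y)\,ds(y),$$ where operators act complex-linearly and $\langle\nu,\nabla P\rangle=\nu_1\partial_1P+\nu_2\partial_2P$. *)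

theory Defs
  imports "HOL-Analysis.Analysis"
begin

text \<open>The plane is identified with the type \<^typ>\<open>complex\<close>; its inner product
  \<open>x \<bullet> y = Re x * Re y + Im x * Im y\<close> and norm are the Euclidean ones.\<close>

subsection \<open>Bounded domains with twice continuously differentiable boundary\<close>

definition C2_function :: "(real \<Rightarrow> real) \<Rightarrow> bool" where
  "C2_function g \<longleftrightarrow>
    (\<exists>g' g''. (\<forall>s. (g has_real_derivative g' s) (at s)) \<and>
              (\<forall>s. (g' has_real_derivative g'' s) (at s)) \<and>
              continuous_on UNIV g'')"

text \<open>Near each boundary point, and in suitably rotated Cartesian coordinates
  \<open>(Re (u * x), Im (u * x))\<close>, the domain is the strict epigraph of a \<open>C\<^sup>2\<close> function;
  so it lies locally on one side of its boundary.\<close>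

definition C2_boundary :: "complex set \<Rightarrow> bool" where
  "C2_boundary D \<longleftrightarrow>
    (\<forall>x0\<in>frontier D. \<exists>r>0. \<exists>u g. norm u = 1 \<and> C2_function g \<and>
       D \<inter> ball x0 r = {x \<in> ball x0 r. g (Re (u * x)) < Im (u * x)})"

definition bounded_C2_domain :: "complex set \<Rightarrow> bool" where
  "bounded_C2_domain D \<longleftrightarrow>
    open D \<and> connected D \<and> D \<noteq> {} \<and> bounded D \<and> C2_boundary D"

text \<open>The second conjunct says that \<open>n\<close> is orthogonal to the tangent line of the boundary
  at \<open>x\<close>; the third one selects the outward direction.\<close>

definition outward_normal :: "complex set \<Rightarrow> complex \<Rightarrow> complex" where
  "outward_normal D x =
    (THE n. norm n = 1 \<and>
       ((\<lambda>y. ((y - x) \<bullet> n) / norm (y - x)) \<longlongrightarrow> 0) (at x within frontier D) \<and>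
       (\<forall>\<^sub>F t in at_right (0::real). x + t *\<^sub>R n \<notin> D))"

subsection \<open>Arc length\<close>

text \<open>The element \<open>ds\<close> is one-dimensional Hausdorff measure restricted to the boundary.
  Boundedness of the covering sets is required because \<^const>\<open>diameter\<close> is only meaningful
  for bounded sets.\<close>

definition hausdorff1_pre :: "real \<Rightarrow> complex set \<Rightarrow> ennreal" where
  "hausdorff1_pre \<delta> A =
    (INF U\<in>{U :: nat \<Rightarrow> complex set. A \<subseteq> (\<Union>i. U i) \<and> (\<forall>i. bounded (U i) \<and> diameter (U i) \<le> \<delta>)}.
       \<Sum>i. ennreal (diameter (U i)))"

definition hausdorff1_outer :: "complex set \<Rightarrow> ennreal" where
  "hausdorff1_outer A = (SUP \<delta>\<in>{0<..}. hausdorff1_pre \<delta> A)"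

definition hausdorff1 :: "complex measure" where
  "hausdorff1 = measure_of UNIV (sets borel) hausdorff1_outer"

definition arc_length :: "complex set \<Rightarrow> complex measure" where
  "arc_length D = restrict_space hausdorff1 (frontier D)"

subsection \<open>Square-integrable functions and invertible operators\<close>

text \<open>Elements of \<open>L\<^sup>2\<close> are represented by functions; equality in \<open>L\<^sup>2\<close> is equality
  almost everywhere.\<close>

definition L2 :: "complex measure \<Rightarrow> (complex \<Rightarrow> complex) set" where
  "L2 M = {\<phi> \<in> borel_measurable M. integrable M (\<lambda>x. (norm (\<phi> x))\<^sup>2)}"

text \<open>\<open>T\<close> induces a well-defined bijection of \<open>L\<^sup>2\<close>. For bounded linear \<open>T\<close>, the inverse
  is then bounded by the open mapping theorem.\<close>

definition L2_invertible ::
  "complex measure \<Rightarrow> ((complex \<Rightarrow> complex) \<Rightarrow> complex \<Rightarrow> complex) \<Rightarrow> bool" where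
  "L2_invertible M T \<longleftrightarrow>
    (\<forall>\<phi>\<in>L2 M. T \<phi> \<in> L2 M) \<and>
    (\<forall>\<phi>\<in>L2 M. \<forall>\<psi>\<in>L2 M. (AE x in M. T \<phi> x = T \<psi> x) \<longleftrightarrow> (AE x in M. \<phi> x = \<psi> x)) \<and>
    (\<forall>f\<in>L2 M. \<exists>\<phi>\<in>L2 M. AE x in M. T \<phi> x = f x)"

text \<open>A representative of \<open>T\<^sup>-\<^sup>1 f\<close>. By convention the inverse of a non-invertible operator
  is zero; this case does not occur for the operators \<open>\<lambda>I - K\<^sub>D\<^sup>*\<close> with \<open>\<lambda> > 1/2\<close>, which are
  invertible on \<open>L\<^sup>2\<close> of the boundary by classical potential theory.\<close>

definition L2_inverse ::
  "complex measure \<Rightarrow> ((complex \<Rightarrow> complex) \<Rightarrow> complex \<Rightarrow> complex)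
     \<Rightarrow> (complex \<Rightarrow> complex) \<Rightarrow> complex \<Rightarrow> complex" where
  "L2_inverse M T f =
    (if L2_invertible M T
     then (SOME \<phi>. \<phi> \<in> L2 M \<and> (AE x in M. T \<phi> x = f x))
     else (\<lambda>_. 0))"

subsection \<open>The Neumann--Poincare operator\<close>

definition NP_operator :: "complex set \<Rightarrow> (complex \<Rightarrow> complex) \<Rightarrow> complex \<Rightarrow> complex" where
  "NP_operator D \<phi> x =
    1 / (2 * complex_of_real pi) *
      (LINT y|arc_length D.
         complex_of_real (((x - y) \<bullet> outward_normal D x) / (norm (x - y))\<^sup>2) * \<phi> y)"

definition NP_resolvent :: "real \<Rightarrow> complex set \<Rightarrow> (complex \<Rightarrow> complex) \<Rightarrow> complex \<Rightarrow> complex" where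
  "NP_resolvent lam D =
    L2_inverse (arc_length D) (\<lambda>\<phi> x. complex_of_real lam * \<phi> x - NP_operator D \<phi> x)"

definition contrast :: "real \<Rightarrow> real" where
  "contrast \<kappa> = (\<kappa> + 1) / (2 * (\<kappa> - 1))"

subsection \<open>Complex contracted generalized polarization tensors\<close>

definition cpoly :: "nat \<Rightarrow> complex \<Rightarrow> complex" where
  "cpoly m x = (complex_of_real (Re x) + \<i> * complex_of_real (Im x)) ^ m"

definition partial1 :: "(complex \<Rightarrow> complex) \<Rightarrow> complex \<Rightarrow> complex" where
  "partial1 F x = vector_derivative (\<lambda>t. F (x + complex_of_real t)) (at 0)"

definition partial2 :: "(complex \<Rightarrow> complex) \<Rightarrow> complex \<Rightarrow> complex" where
  "partial2 F x = vector_derivative (\<lambda>t. F (x + \<i> * complex_of_real t)) (at 0)"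

definition normal_derivative ::
  "complex set \<Rightarrow> (complex \<Rightarrow> complex) \<Rightarrow> complex \<Rightarrow> complex" where
  "normal_derivative D F x =
    complex_of_real (Re (outward_normal D x)) * partial1 F x +
    complex_of_real (Im (outward_normal D x)) * partial2 F x"

definition CGPT1 :: "real \<Rightarrow> complex set \<Rightarrow> nat \<Rightarrow> nat \<Rightarrow> complex" where
  "CGPT1 lam D m n =
    (LINT y|arc_length D.
       cpoly n y * NP_resolvent lam D (normal_derivative D (cpoly m)) y)"

definition CGPT2 :: "real \<Rightarrow> complex set \<Rightarrow> nat \<Rightarrow> nat \<Rightarrow> complex" where
  "CGPT2 lam D m n =
    (LINT y|arc_length D.
       cpoly n y * NP_resolvent lam D (normal_derivative D (\<lambda>x. cnj (cpoly m x))) y)"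

subsection \<open>Hausdorff measure is countably additive on the Borel sets\<close>

text \<open>\<^const>\<open>measure_of\<close> yields the zero measure when its argument is not countably
  additive. Caratheodory's criterion for metric outer measures shows that this default
  does not apply to \<open>hausdorff1\<close>; see \<open>emeasure_hausdorff1\<close>.\<close>

lemma hausdorff1_pre_le:
  assumes "A \<subseteq> (\<Union>i. U i)" "\<And>i. bounded (U i)" "\<And>i. diameter (U i) \<le> d"
  shows "hausdorff1_pre d A \<le> (\<Sum>i. ennreal (diameter (U i)))"
  unfolding hausdorff1_pre_def by (rule INF_lower) (use assms in auto)

lemma hausdorff1_pre_mono: "A \<subseteq> B \<Longrightarrow> hausdorff1_pre d A \<le> hausdorff1_pre d B"
  unfolding hausdorff1_pre_def by (rule INF_superset_mono) auto

lemma hausdorff1_pre_antimono: "d \<le> e \<Longrightarrow> hausdorff1_pre e A \<le> hausdorff1_pre d A"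
  unfolding hausdorff1_pre_def by (rule INF_superset_mono) (auto intro: order_trans)

lemma hausdorff1_pre_empty: "0 < d \<Longrightarrow> hausdorff1_pre d {} = 0"
  using hausdorff1_pre_le[of "{}" "\<lambda>_. {}" d] by simp

lemma hausdorff1_pre_countably_subadditive:
  assumes "0 < d"
  shows "hausdorff1_pre d (\<Union>i. A i) \<le> (\<Sum>n. hausdorff1_pre d (A n))"
proof (rule ennreal_le_epsilon)
  fix e :: real assume "0 < e" and "(\<Sum>n. hausdorff1_pre d (A n)) < top"
  then have *: "\<And>n. hausdorff1_pre d (A n) < hausdorff1_pre d (A n) + e * (1/2)^Suc n"
    by (auto simp add: less_top dest!: ennreal_suminf_lessD)
  have "\<exists>U. A n \<subseteq> (\<Union>i. U i) \<and> (\<forall>i. bounded (U i) \<and> diameter (U i) \<le> d) \<and>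
     (\<Sum>i. ennreal (diameter (U i))) \<le> hausdorff1_pre d (A n) + e * (1/2)^Suc n" for n
    using *[of n] unfolding hausdorff1_pre_def[of d "A n"] INF_less_iff
    by (auto intro: less_imp_le)
  then obtain B where B: "\<And>n. A n \<subseteq> (\<Union>i. B n i)"
    and Bb: "\<And>n i. bounded (B n i)" and Bd: "\<And>n i. diameter (B n i) \<le> d"
    and Ble: "\<And>n. (\<Sum>i. ennreal (diameter (B n i))) \<le> hausdorff1_pre d (A n) + e * (1/2)^Suc n"
    by metis
  define C where "C = case_prod B o prod_decode"
  have "hausdorff1_pre d (\<Union>i. A i) \<le> (\<Sum>i. ennreal (diameter (C i)))"
  proof (rule hausdorff1_pre_le)
    show "(\<Union>i. A i) \<subseteq> (\<Union>i. C i)"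
      using B by (auto simp add: C_def subset_eq) (metis prod.case prod_encode_inverse)
  qed (auto simp: C_def Bb Bd split: prod.split)
  also have "\<dots> = (\<Sum>n. \<Sum>i. ennreal (diameter (B n i)))"
    using suminf_ennreal_2dimen[of "\<lambda>n. \<Sum>i. ennreal (diameter (B n i))" "\<lambda>(n,i). ennreal (diameter (B n i))"]
    by (simp add: C_def split_def)
  also have "\<dots> \<le> (\<Sum>n. hausdorff1_pre d (A n) + e * (1/2) ^ Suc n)"
    by (intro suminf_le allI Ble) auto
  also have "... = (\<Sum>n. hausdorff1_pre d (A n)) + (\<Sum>n. ennreal e * ennreal ((1/2) ^ Suc n))"
    using \<open>0 < e\<close> by (subst suminf_add[symmetric])
                     (auto simp del: ennreal_suminf_cmult simp add: ennreal_mult[symmetric])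
  also have "\<dots> = (\<Sum>n. hausdorff1_pre d (A n)) + e"
    unfolding ennreal_suminf_cmult
    by (subst suminf_ennreal_eq[OF zero_le_power power_half_series]) auto
  finally show "hausdorff1_pre d (\<Union>i. A i) \<le> (\<Sum>n. hausdorff1_pre d (A n)) + e" .
qed

lemma hausdorff1_outer_mono: "A \<subseteq> B \<Longrightarrow> hausdorff1_outer A \<le> hausdorff1_outer B"
  unfolding hausdorff1_outer_def by (rule SUP_mono') (rule hausdorff1_pre_mono)

lemma hausdorff1_pre_le_outer: "0 < d \<Longrightarrow> hausdorff1_pre d A \<le> hausdorff1_outer A"
  unfolding hausdorff1_outer_def by (rule SUP_upper) auto

lemma hausdorff1_outer_empty: "hausdorff1_outer {} = 0"
  unfolding hausdorff1_outer_def by (simp add: hausdorff1_pre_empty)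

lemma hausdorff1_outer_countably_subadditive: "hausdorff1_outer (\<Union>i. A i) \<le> (\<Sum>n. hausdorff1_outer (A n))"
  unfolding hausdorff1_outer_def[of "\<Union>i. A i"]
proof (rule SUP_least)
  fix d :: real assume "d \<in> {0<..}"
  then show "hausdorff1_pre d (\<Union>i. A i) \<le> (\<Sum>n. hausdorff1_outer (A n))"
    by (intro order_trans[OF hausdorff1_pre_countably_subadditive] suminf_le hausdorff1_pre_le_outer) auto
qed

lemma outer_measure_space_hausdorff1: "outer_measure_space (Pow UNIV) hausdorff1_outer"
  unfolding outer_measure_space_def positive_def increasing_def countably_subadditive_def
  by (auto simp: hausdorff1_outer_empty hausdorff1_outer_mono hausdorff1_outer_countably_subadditive)

lemma hausdorff1_outer_Un_le: "hausdorff1_outer (A \<union> B) \<le> hausdorff1_outer A + hausdorff1_outer B"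
proof -
  have "subadditive (Pow UNIV) hausdorff1_outer"
    using outer_measure_space_hausdorff1 unfolding outer_measure_space_def
    using ring_of_sets.countably_subadditive_subadditive[OF algebra.axioms(1)[OF algebra_Pow]]
    by blast
  then have *: "hausdorff1_outer (A \<union> (B - A)) \<le> hausdorff1_outer A + hausdorff1_outer (B - A)"
    unfolding subadditive_def by blast
  then show ?thesis by (simp add: order_trans[OF _ add_left_mono[OF hausdorff1_outer_mono]])
qed

lemma hausdorff1_pre_separated:
  assumes sep: "\<And>a b. a \<in> A \<Longrightarrow> b \<in> B \<Longrightarrow> d < dist a b"
  shows "hausdorff1_pre d A + hausdorff1_pre d B \<le> hausdorff1_pre d (A \<union> B)"
  unfolding hausdorff1_pre_def[of d "A \<union> B"]
proof (rule INF_greatest, clarify)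
  fix U :: "nat \<Rightarrow> complex set"
  assume U: "A \<union> B \<subseteq> (\<Union>i. U i)" "\<forall>i. bounded (U i) \<and> diameter (U i) \<le> d"
  define V where "V = (\<lambda>i. if U i \<inter> A \<noteq> {} then U i else {})"
  define W where "W = (\<lambda>i. if U i \<inter> B \<noteq> {} then U i else {})"
  have d0: "0 \<le> d" using U(2) diameter_ge_0 order_trans by blast
  have 1: "hausdorff1_pre d A \<le> (\<Sum>i. ennreal (diameter (V i)))"
  proof (rule hausdorff1_pre_le)
    show "A \<subseteq> (\<Union>i. V i)" using U(1) unfolding V_def by fastforce
  qed (use U(2) d0 in \<open>auto simp: V_def\<close>)
  have 2: "hausdorff1_pre d B \<le> (\<Sum>i. ennreal (diameter (W i)))"
  proof (rule hausdorff1_pre_le)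
    show "B \<subseteq> (\<Union>i. W i)" using U(1) unfolding W_def by fastforce
  qed (use U(2) d0 in \<open>auto simp: W_def\<close>)
  have 3: "ennreal (diameter (V i)) + ennreal (diameter (W i)) \<le> ennreal (diameter (U i))" for i
  proof -
    have "U i \<inter> A = {} \<or> U i \<inter> B = {}"
    proof (rule ccontr)
      assume "\<not> ?thesis"
      then obtain a b where "a \<in> U i" "a \<in> A" "b \<in> U i" "b \<in> B" by blast
      then show False
        using sep[of a b] U(2)[rule_format, of i] diameter_bounded_bound[of "U i" a b] by linarith
    qed
    then show ?thesis by (auto simp: V_def W_def)
  qed
  have "hausdorff1_pre d A + hausdorff1_pre d B \<le>
     (\<Sum>i. ennreal (diameter (V i))) + (\<Sum>i. ennreal (diameter (W i)))"
    by (intro add_mono 1 2)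
  also have "\<dots> = (\<Sum>i. ennreal (diameter (V i)) + ennreal (diameter (W i)))"
    by (intro suminf_add) auto
  also have "\<dots> \<le> (\<Sum>i. ennreal (diameter (U i)))"
    by (intro suminf_le 3) auto
  finally show "hausdorff1_pre d A + hausdorff1_pre d B \<le> (\<Sum>i. ennreal (diameter (U i)))" .
qed

lemma hausdorff1_outer_separated:
  assumes r: "0 < r" and sep: "\<And>a b. a \<in> A \<Longrightarrow> b \<in> B \<Longrightarrow> r \<le> dist a b"
  shows "hausdorff1_outer A + hausdorff1_outer B \<le> hausdorff1_outer (A \<union> B)"
proof -
  have "hausdorff1_pre d A + hausdorff1_pre e B \<le> hausdorff1_outer (A \<union> B)" if "0 < d" "0 < e" for d e
  proof -
    define c where "c = min (r/2) (min d e)"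
    have c: "0 < c" "c \<le> d" "c \<le> e" "c < r" using r that by (auto simp: c_def)
    have "hausdorff1_pre d A + hausdorff1_pre e B \<le> hausdorff1_pre c A + hausdorff1_pre c B"
      by (intro add_mono hausdorff1_pre_antimono c)
    also have "\<dots> \<le> hausdorff1_pre c (A \<union> B)"
      by (rule hausdorff1_pre_separated) (use sep c in force)
    also have "\<dots> \<le> hausdorff1_outer (A \<union> B)" by (rule hausdorff1_pre_le_outer) fact
    finally show ?thesis .
  qed
  then have "(SUP d\<in>{0<..}. SUP e\<in>{0<..}. hausdorff1_pre d A + hausdorff1_pre e B)
      \<le> hausdorff1_outer (A \<union> B)"
    by (auto intro!: SUP_least)
  moreover have "hausdorff1_outer A + hausdorff1_outer B =
      (SUP d\<in>{0<..}. SUP e\<in>{0<..}. hausdorff1_pre d A + hausdorff1_pre e B)"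
    by (simp add: hausdorff1_outer_def ennreal_SUP_add_left[symmetric] ennreal_SUP_add_right)
       (rule SUP_commute)
  ultimately show ?thesis by simp
qed

lemma closed_in_lambda_system_hausdorff1:
  assumes "closed C"
  shows "C \<in> lambda_system UNIV (Pow UNIV) hausdorff1_outer"
proof -
  let ?H = hausdorff1_outer
  have "?H (A \<inter> C) + ?H (A - C) \<le> ?H A" for A
  proof (cases "?H A = top \<or> C = {}")
    case True then show ?thesis by (auto simp: hausdorff1_outer_empty)
  next
    case False
    then have fin: "?H A < top" and ne: "C \<noteq> {}" by (auto simp: less_top)
    define S where "S k = {x \<in> A. 1 / real (Suc k) \<le> infdist x C}" for k
    have mono: "S k \<subseteq> S l" if "k \<le> l" for k l
    proof -
      have "1 / real (Suc l) \<le> 1 / real (Suc k)" using that by (simp add: frac_le)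
      then show ?thesis unfolding S_def by force
    qed
    have US: "(\<Union>k. S k) = A - C"
    proof -
      have "\<exists>k. 1 / real (Suc k) \<le> infdist x C" if "x \<notin> C" for x
      proof -
        have "0 < infdist x C"
          using that assms ne by (simp add: infdist_pos_not_in_closed)
        then obtain n where "inverse (real (Suc n)) < infdist x C"
          using reals_Archimedean by blast
        then show ?thesis by (intro exI[of _ n]) (simp add: divide_inverse)
      qed
      then show ?thesis unfolding S_def by (auto dest: infdist_zero)
    qed
    have step: "?H (A \<inter> C) + ?H (S k) \<le> ?H A" for k
    proof -
      have "?H (A \<inter> C) + ?H (S k) \<le> ?H ((A \<inter> C) \<union> S k)"
      proof (rule hausdorff1_outer_separated[of "1 / real (Suc k)"])
        fix a b assume "a \<in> A \<inter> C" "b \<in> S k"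
        then show "1 / real (Suc k) \<le> dist a b"
          using infdist_le[of a C b] by (auto simp: S_def dist_commute intro: order_trans)
      qed simp
      also have "\<dots> \<le> ?H A" by (rule hausdorff1_outer_mono) (auto simp: S_def)
      finally show ?thesis .
    qed
    define R where "R k = S (Suc k) - S k" for k
    have sepR: "0 < 1 / real (Suc (Suc k)) - 1 / real (Suc (Suc k) + 1) \<and>
        (\<forall>a\<in>S (Suc k). \<forall>b\<in>R l. 1 / real (Suc (Suc k)) - 1 / real (Suc (Suc k) + 1) \<le> dist a b)"
      if "Suc (Suc k) \<le> l" for k l
    proof (intro conjI ballI)
      show "0 < 1 / real (Suc (Suc k)) - 1 / real (Suc (Suc k) + 1)"
        by (simp add: frac_less2)
      fix a b assume a: "a \<in> S (Suc k)" and b: "b \<in> R l"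
      have "infdist b C < 1 / real (Suc l)" using b by (auto simp: R_def S_def)
      moreover have "1 / real (Suc l) \<le> 1 / real (Suc (Suc k) + 1)" using that by (simp add: frac_le)
      moreover have "1 / real (Suc (Suc k)) \<le> infdist a C" using a by (auto simp: S_def)
      moreover have "infdist a C \<le> infdist b C + dist a b" by (rule infdist_triangle)
      ultimately show "1 / real (Suc (Suc k)) - 1 / real (Suc (Suc k) + 1) \<le> dist a b" by linarith
    qed
    have par: "(\<Sum>j<n. ?H (R (2 * j + q))) \<le> ?H (\<Union>j<n. R (2 * j + q))" for q n
    proof (induction n)
      case 0 show ?case by (simp add: hausdorff1_outer_empty)
    next
      case (Suc n)
      have "?H (\<Union>j<n. R (2 * j + q)) + ?H (R (2 * n + q)) \<le> ?H ((\<Union>j<n. R (2 * j + q)) \<union> R (2 * n + q))"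
      proof (cases n)
        case 0 then show ?thesis by (simp add: hausdorff1_outer_empty)
      next
        case (Suc k)
        have sub: "(\<Union>j<n. R (2 * j + q)) \<subseteq> S (Suc (2 * k + q))"
        proof clarify
          fix x j assume "j < n" "x \<in> R (2 * j + q)"
          then show "x \<in> S (Suc (2 * k + q))"
            using mono[of "Suc (2 * j + q)" "Suc (2 * k + q)"] Suc by (auto simp: R_def)
        qed
        have "Suc (Suc (2 * k + q)) \<le> 2 * n + q" using Suc by simp
        from sepR[OF this] sub show ?thesis
          by (intro hausdorff1_outer_separated) blast+
      qed
      moreover have "(\<Union>j<n. R (2 * j + q)) \<union> R (2 * n + q) = (\<Union>j<Suc n. R (2 * j + q))"
        by (auto simp: lessThan_Suc)
      ultimately show ?case
        using add_right_mono[OF Suc.IH, of "?H (R (2 * n + q))"] by (metis (no_types, lifting) order_trans sum.lessThan_Suc)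
    qed
    have par': "(\<Sum>j<n. ?H (R (2 * j + q))) \<le> ?H A" for n q
      by (rule order_trans[OF par hausdorff1_outer_mono]) (auto simp: R_def S_def)
    have bnd: "(\<Sum>j<n. ?H (R j)) \<le> ?H A + ?H A" for n
    proof -
      have "(\<Sum>j<n. ?H (R j)) \<le> (\<Sum>j<2*n. ?H (R j))"
        by (intro sum_mono2) auto
      also have "\<dots> = (\<Sum>j<n. ?H (R (2 * j + 0))) + (\<Sum>j<n. ?H (R (2 * j + 1)))"
        by (induction n) (simp_all add: ac_simps)
      also have "\<dots> \<le> ?H A + ?H A" by (intro add_mono par')
      finally show ?thesis .
    qed
    then have "(\<Sum>j. ?H (R j)) \<le> ?H A + ?H A"
      by (intro suminf_le_const summableI)
    then have finR: "(\<Sum>j. ?H (R j)) < top" using fin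
      by (meson ennreal_add_less_top le_less_trans)
    have tail: "?H (A - C) \<le> ?H (S k) + (\<Sum>j. ?H (R (j + k)))" for k
    proof -
      have *: "x \<in> S k \<union> (\<Union>j. R (j + k))" if "x \<in> S l" for x l
        using that
      proof (induction l)
        case 0 then show ?case using mono[of 0 k] by auto
      next
        case (Suc l)
        show ?case
        proof (cases "x \<in> S l \<or> Suc l \<le> k")
          case True then show ?thesis using Suc mono[of "Suc l" k] by auto
        next
          case False
          then have "x \<in> R ((l - k) + k)" using Suc.prems by (auto simp: R_def)
          then show ?thesis by blast
        qed
      qed
      then have "A - C \<subseteq> S k \<union> (\<Union>j. R (j + k))" unfolding US[symmetric] by blast
      then have "?H (A - C) \<le> ?H (S k \<union> (\<Union>j. R (j + k)))" by (rule hausdorff1_outer_mono)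
      also have "\<dots> \<le> ?H (S k) + ?H (\<Union>j. R (j + k))" by (rule hausdorff1_outer_Un_le)
      also have "\<dots> \<le> ?H (S k) + (\<Sum>j. ?H (R (j + k)))" by (intro add_left_mono hausdorff1_outer_countably_subadditive)
      finally show ?thesis .
    qed
    show ?thesis
    proof (rule ennreal_le_epsilon)
      fix e :: real assume e: "0 < e"
      let ?s = "\<Sum>j. ?H (R j)"
      have "(\<lambda>k. \<Sum>j<k. ?H (R j)) \<longlonglongrightarrow> ?s" by (intro summable_LIMSEQ summableI)
      have "\<exists>k. ?s \<le> (\<Sum>j<k. ?H (R j)) + e"
      proof (rule ccontr)
        assume "\<not> ?thesis"
        then have *: "\<And>k. (\<Sum>j<k. ?H (R j)) + e \<le> ?s" by (meson linear)
        have "?s + e \<le> ?s"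
          using LIMSEQ_le_const2[OF tendsto_add[OF \<open>(\<lambda>k. \<Sum>j<k. ?H (R j)) \<longlonglongrightarrow> ?s\<close> tendsto_const[of "ennreal e"]]] *
          by blast
        then show False using finR e
          by (cases ?s) (auto simp: ennreal_plus[symmetric] simp del: ennreal_plus)
      qed
      then obtain k where k: "?s \<le> (\<Sum>j<k. ?H (R j)) + e" by blast
      let ?P = "\<Sum>j<k. ?H (R j)"
      have split: "?s = ?P + (\<Sum>j. ?H (R (j + k)))"
        by (subst add.commute) (rule suminf_offset, rule summableI)
      then have "?P \<le> ?s" by (metis le_iff_add)
      then have "?P \<noteq> \<infinity>" using finR by (metis infinity_ennreal_def le_less_trans less_irrefl)
      moreover have "?P + (\<Sum>j. ?H (R (j + k))) \<le> ?P + e" using k unfolding split .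
      ultimately have tk: "(\<Sum>j. ?H (R (j + k))) \<le> e"
        unfolding ennreal_add_left_cancel_le by blast
      have "?H (A \<inter> C) + ?H (A - C) \<le> (?H (A \<inter> C) + ?H (S k)) + (\<Sum>j. ?H (R (j + k)))"
        using tail[of k] by (simp add: add.assoc add_left_mono)
      also have "\<dots> \<le> ?H A + e" by (intro add_mono step tk)
      finally show "?H (A \<inter> C) + ?H (A - C) \<le> ?H A + e" .
    qed
  qed
  moreover have "?H A \<le> ?H (A \<inter> C) + ?H (A - C)" for A
    using hausdorff1_outer_Un_le[of "A \<inter> C" "A - C"] by (simp add: Int_Diff_Un)
  ultimately have "?H (A \<inter> C) + ?H (A - C) = ?H A" for A
    by (intro antisym)
  then show ?thesis
    unfolding algebra.lambda_system_eq[OF algebra_Pow] by blast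
qed

lemma emeasure_hausdorff1:
  assumes "A \<in> sets borel"
  shows "emeasure hausdorff1 A = hausdorff1_outer A"
proof -
  let ?L = "lambda_system UNIV (Pow UNIV) hausdorff1_outer"
  have ms: "measure_space UNIV ?L hausdorff1_outer"
    using sigma_algebra.caratheodory_lemma[OF sigma_algebra_Pow outer_measure_space_hausdorff1] .
  then interpret L: sigma_algebra UNIV ?L by (simp add: measure_space_def)
  have "sigma_sets UNIV (Collect closed) \<subseteq> ?L"
    by (rule L.sigma_sets_subset) (use closed_in_lambda_system_hausdorff1 in blast)
  then have "sets borel \<subseteq> ?L"
    by (simp add: borel_eq_closed)
  then have "measure_space UNIV (sets borel) hausdorff1_outer"
    using measure_down[OF ms] sets.sigma_algebra_axioms[of borel] by simp
  then show ?thesis using assms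
    unfolding hausdorff1_def measure_space_def
    by (intro emeasure_measure_of_sigma) auto
qed

end

theory Submission
  imports Defs
begin

text \<open>Let \<open>w = exp (2 \<pi> \<i> / p)\<close> and let \<open>T = \<lambda>I - K\<^sub>D\<^sup>*\<close>. Multiplication by \<open>w\<close> maps the boundary onto
  itself, preserves arc length (\<open>distr_rotation_arc_length\<close>) and carries outward normals to
  outward normals (\<open>outward_normal_rotation\<close>). The kernel of \<open>K\<^sub>D\<^sup>*\<close> depends on these data only,
  so \<open>T\<close> commutes with the rotation of functions (\<open>NP_operator_rotation\<close>).

  The Neumann datum \<open>f\<close> of \<open>P\<^sub>m\<close> satisfies \<open>f (w x) = w^m f x\<close>, and that of the conjugate of
  \<open>P\<^sub>m\<close> the same equation with \<open>w^(-m)\<close>. Since \<open>T\<close> is injective on \<open>L\<^sup>2\<close>, the density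
  \<open>\<phi> = T\<^sup>-\<^sup>1 f\<close> transforms with the same factor (\<open>NP_resolvent_rotation\<close>). The change of
  variables \<open>y \<mapsto> w y\<close> in the integral of \<open>y^n \<phi> y\<close> therefore multiplies the tensor by
  \<open>w^(n+m)\<close> or \<open>w^(n-m)\<close>, so that it can be nonzero only if this factor is \<open>1\<close>, that is, if \<open>p\<close>
  divides the exponent.

  The analytic content lies in the normal and in integrability. The outward normal is
  given by a definite description, so equivariance needs existence and uniqueness of a
  vector with the stated properties; both are read off from the graph charts of the boundary
  (\<open>outward_normal_graph_chart\<close>), and so is continuity of the normal. An inverse image under \<open>T\<close>
  is available only for \<open>f\<close> in \<open>L\<^sup>2\<close>; as \<open>f\<close> is measurable and bounded, this follows from the finite
  length of the boundary (\<open>finite_measure_arc_length\<close>), a compact set covered by finitely many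
  graphs of Lipschitz functions.\<close>

section \<open>The normal vector in a graph chart\<close>

text \<open>The local description of the boundary from \<^const>\<open>C2_boundary\<close>, with the regularity of \<open>g\<close> left
  out; \<open>u\<close> turns the plane into the coordinates of the graph.\<close>

definition graph_chart :: "complex set \<Rightarrow> complex \<Rightarrow> real \<Rightarrow> complex \<Rightarrow> (real \<Rightarrow> real) \<Rightarrow> bool" where
  "graph_chart D x0 r u g \<longleftrightarrow> norm u = 1 \<and>
     D \<inter> ball x0 r = {x \<in> ball x0 r. g (Re (u * x)) < Im (u * x)}"

lemma unit_mult_cnj [simp]: "norm u = 1 \<Longrightarrow> u * cnj u = 1" "norm u = 1 \<Longrightarrow> cnj u * u = 1"
  using complex_norm_square[of u] by (auto simp: mult.commute)

lemma unit_mult_cnj_left [simp]: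
  "norm u = 1 \<Longrightarrow> u * (cnj u * z) = z" "norm u = 1 \<Longrightarrow> cnj u * (u * z) = z"
  by (simp_all add: mult.assoc[symmetric])

lemma graph_chartD:
  assumes "graph_chart D x0 r u g"
  shows "norm u = 1" and "y \<in> ball x0 r \<Longrightarrow> y \<in> D \<longleftrightarrow> g (Re (u * y)) < Im (u * y)"
  using assms unfolding graph_chart_def by blast+

text \<open>Openness of \<open>D\<close> excludes points above the graph, and points below it have a
  neighbourhood that misses \<open>D\<close>. A point on the graph is the limit of points straight above it.\<close>

lemma frontier_graph_chart:
  assumes "open D" and chart: "graph_chart D x0 r u g" and g: "continuous_on UNIV g"
    and x: "x \<in> ball x0 r"
  shows "x \<in> frontier D \<longleftrightarrow> g (Re (u * x)) = Im (u * x)"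
proof -
  have u: "norm u = 1" and D: "\<And>y. y \<in> ball x0 r \<Longrightarrow> y \<in> D \<longleftrightarrow> g (Re (u * y)) < Im (u * y)"
    using graph_chartD[OF chart] by blast+
  have cont: "continuous_on UNIV (\<lambda>y. g (Re (u * y)))"
    by (rule continuous_on_compose2[OF g]) (auto intro!: continuous_intros)
  show ?thesis
  proof
    assume fr: "x \<in> frontier D"
    then have "x \<notin> D" using \<open>open D\<close> by (simp add: frontier_def interior_open)
    then have ge: "Im (u * x) \<le> g (Re (u * x))" using D[OF x] by simp
    define V where "V = {y. Im (u * y) < g (Re (u * y))} \<inter> ball x0 r"
    have "open V" unfolding V_def
      by (intro open_Int open_Collect_less cont continuous_intros open_ball)
    moreover have "V \<inter> D = {}" unfolding V_def by (auto dest: D)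
    ultimately have "V \<inter> closure D = {}" by (simp add: open_Int_closure_eq_empty)
    then have "x \<notin> V" using fr by (auto simp: frontier_def)
    then show "g (Re (u * x)) = Im (u * x)" using ge x by (auto simp: V_def)
  next
    assume eq: "g (Re (u * x)) = Im (u * x)"
    define y where "y = (\<lambda>t::real. x + cnj u * (\<i> * of_real t))"
    have "((\<lambda>t. x + cnj u * (\<i> * of_real t)) \<longlongrightarrow> x + cnj u * (\<i> * of_real 0)) (at_right (0::real))"
      by (intro tendsto_intros)
    then have lim: "(y \<longlongrightarrow> x) (at_right 0)" by (simp add: y_def)
    have "\<forall>\<^sub>F t in at_right 0. y t \<in> ball x0 r"
      using lim x by (intro topological_tendstoD[OF lim]) auto
    moreover have "\<forall>\<^sub>F t in at_right (0::real). 0 < t"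
      by (simp add: eventually_at_right_less)
    ultimately have "\<forall>\<^sub>F t in at_right 0. y t \<in> D"
    proof eventually_elim
      case (elim t)
      have "u * y t = u * x + \<i> * of_real t" using u by (simp add: y_def distrib_left)
      then show ?case using D[OF elim(1)] eq elim(2) by simp
    qed
    then have "x \<in> closure D"
      by (intro Lim_in_closed_set[OF closed_closure _ _ lim])
        (auto elim!: eventually_mono intro: closure_subset[THEN subsetD])
    moreover have "x \<notin> D" using D[OF x] eq by simp
    ultimately show "x \<in> frontier D" using \<open>open D\<close> by (simp add: frontier_def interior_open)
  qed
qed

text \<open>The formula is the clockwise unit normal to the tangent vector \<open>(1, g')\<close> of the graph. It has
  to be shown to be the only vector that meets the description in \<^const>\<open>outward_normal\<close>, since
  a definite description without a unique witness carries no information. Orthogonality to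
  the tangent is the first-order Taylor expansion of \<open>g\<close>; conversely, letting boundary points
  approach \<open>x\<close> along the graph forces any admissible vector to be orthogonal to \<open>(1, g')\<close>, which
  leaves two opposite candidates, and the side condition rules out the one that points into
  the epigraph.\<close>

lemma outward_normal_graph_chart:
  assumes "open D" and chart: "graph_chart D x0 r u g"
    and g: "\<And>s. (g has_real_derivative g' s) (at s)"
    and x: "x \<in> ball x0 r" and fr: "x \<in> frontier D"
  shows "outward_normal D x = cnj u * (- \<i> * sgn (Complex 1 (g' (Re (u * x)))))"
proof -
  have u: "norm u = 1" and D: "\<And>y. y \<in> ball x0 r \<Longrightarrow> y \<in> D \<longleftrightarrow> g (Re (u * y)) < Im (u * y)"
    using graph_chartD[OF chart] by blast+
  have cont: "continuous_on UNIV g"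
    using g by (meson DERIV_isCont continuous_at_imp_continuous_on)
  note frontier = frontier_graph_chart[OF \<open>open D\<close> chart cont]
  define s0 where "s0 = Re (u * x)"
  define a where "a = g' s0"
  define q where "q = sqrt (1 + a\<^sup>2)"
  have q: "q > 0" "q\<^sup>2 = 1 + a\<^sup>2" by (auto simp: q_def add_pos_nonneg)
  have eq: "g s0 = Im (u * x)" using frontier[OF x] fr by (simp add: s0_def)
  define \<gamma> where "\<gamma> = (\<lambda>s. cnj u * Complex s (g s))"
  have ux: "u * x = Complex s0 (g s0)" by (simp only: eq) (simp only: s0_def complex_surj)
  have x\<gamma>: "x = \<gamma> s0"
    using arg_cong[OF ux, of "\<lambda>z. cnj u * z"] u by (simp add: \<gamma>_def)
  have u\<gamma>: "u * \<gamma> s = Complex s (g s)" for s using u by (simp add: \<gamma>_def)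
  have small: "\<exists>d>0. \<forall>s. \<bar>s - s0\<bar> < d \<longrightarrow> \<bar>g s - g s0 - a * (s - s0)\<bar> \<le> e * \<bar>s - s0\<bar>" if "e > 0" for e
    using g[of s0] that unfolding has_field_derivative_def has_derivative_at_alt a_def
    by (auto simp: mult.commute)
  have inner: "z \<bullet> (cnj u * w) = (u * z) \<bullet> w" for z w
    by (simp add: inner_complex_def algebra_simps)
  have nu: "norm (u * z) = norm z" for z using u by (simp add: norm_mult)
  define n where "n = Complex (a / q) (- 1 / q)"
  have sgn: "- \<i> * sgn (Complex 1 a) = n"
    by (simp add: n_def sgn_div_norm complex_eq_iff q_def complex_norm divide_inverse mult.commute)
  have n1: "norm n = 1"
  proof -
    have "(norm n)\<^sup>2 = a\<^sup>2 / q\<^sup>2 + 1 / q\<^sup>2" by (simp add: n_def cmod_power2 power_divide)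
    also have "\<dots> = (1 + a\<^sup>2) / q\<^sup>2" by (simp add: add_divide_distrib)
    also have "\<dots> = 1" unfolding q(2)[symmetric] using q(1) by simp
    finally show ?thesis using norm_ge_zero[of n] by (auto simp: power2_eq_1_iff)
  qed
  \<comment> \<open>The chord from \<open>x\<close> to a boundary point deviates from the tangent by at most \<open>e\<close> times its length.\<close>
  have tang: "\<forall>\<^sub>F y in at x within frontier D. \<bar>((y - x) \<bullet> (cnj u * n)) / norm (y - x)\<bar> \<le> e"
    if "e > 0" for e
  proof -
    obtain d where d: "d > 0" "\<And>s. \<bar>s - s0\<bar> < d \<Longrightarrow> \<bar>g s - g s0 - a * (s - s0)\<bar> \<le> e * \<bar>s - s0\<bar>"
      using small[OF \<open>e > 0\<close>] by blast
    have "\<forall>\<^sub>F y in at x within frontier D. y \<in> frontier D"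
      by (simp add: eventually_at_filter)
    moreover have "\<forall>\<^sub>F y in at x within frontier D. y \<in> ball x0 r"
      using x by (auto simp: eventually_at_topological intro!: exI[of _ "ball x0 r"])
    moreover have "\<forall>\<^sub>F y in at x within frontier D. dist y x < d"
      using d(1) by (auto simp: eventually_at)
    ultimately show ?thesis
    proof eventually_elim
      case (elim y)
      define s where "s = Re (u * y)"
      have uy: "u * y = Complex s (g s)"
        unfolding s_def using frontier[OF elim(2)] elim(1) by (metis complex_surj)
      have diff: "u * (y - x) = Complex (s - s0) (g s - g s0)"
        by (simp add: right_diff_distrib uy ux complex_eq_iff)
      have le: "\<bar>s - s0\<bar> \<le> norm (y - x)"
        using abs_Re_le_cmod[of "u * (y - x)"] by (simp add: diff nu[symmetric, of "y - x"])
      have "((y - x) \<bullet> (cnj u * n)) = (a * (s - s0) - (g s - g s0)) / q"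
        unfolding inner diff by (simp add: n_def inner_complex_def diff_divide_distrib add_divide_distrib algebra_simps)
      then have "\<bar>((y - x) \<bullet> (cnj u * n))\<bar> = \<bar>g s - g s0 - a * (s - s0)\<bar> / q"
        using q(1) by (simp add: abs_minus_commute)
      also have "\<dots> \<le> \<bar>g s - g s0 - a * (s - s0)\<bar>"
      proof -
        have "1 \<le> q" by (simp add: q_def)
        then show ?thesis using q(1) by (simp add: divide_le_eq mult_left_le mult_le_cancel_left1)
      qed
      also have "\<dots> \<le> e * \<bar>s - s0\<bar>"
        using le elim(3) by (intro d(2)) (simp add: dist_norm)
      also have "\<dots> \<le> e * norm (y - x)" using le \<open>e > 0\<close> by simp
      finally show ?case using \<open>e > 0\<close>
        by (cases "y = x") (simp_all add: divide_le_eq)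
    qed
  qed
  have perp: "((\<lambda>y. ((y - x) \<bullet> (cnj u * n)) / norm (y - x)) \<longlongrightarrow> 0) (at x within frontier D)"
    unfolding tendsto_iff
  proof (intro allI impI)
    fix e :: real assume "e > 0"
    show "\<forall>\<^sub>F y in at x within frontier D. dist (((y - x) \<bullet> (cnj u * n)) / norm (y - x)) 0 < e"
      unfolding dist_real_def diff_0_right using \<open>e > 0\<close>
      by (intro eventually_mono[OF tang[of "e / 2"]]) linarith+
  qed
  \<comment> \<open>Moving by \<open>t\<close> along \<open>n\<close> changes the abscissa by \<open>t a / q\<close> and the ordinate by \<open>- t / q\<close>. With error
    constant \<open>1\<close> in the expansion of \<open>g\<close>, both claims come down to \<open>\<bar>a\<bar> < 1 + a\<^sup>2\<close>.\<close>
  have side: "\<forall>\<^sub>F t in at_right (0::real). x + t *\<^sub>R (cnj u * n) \<notin> D \<and> x + t *\<^sub>R - (cnj u * n) \<in> D"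
  proof -
    obtain d where d: "d > 0" "\<And>s. \<bar>s - s0\<bar> < d \<Longrightarrow> \<bar>g s - g s0 - a * (s - s0)\<bar> \<le> 1 * \<bar>s - s0\<bar>"
      using small[of 1] by auto
    have inball: "\<forall>\<^sub>F t in at_right (0::real). x + t *\<^sub>R v \<in> ball x0 r" for v
    proof (rule topological_tendstoD)
      have "((\<lambda>t. x + t *\<^sub>R v) \<longlongrightarrow> x + 0 *\<^sub>R v) (at_right 0)" by (intro tendsto_intros)
      then show "((\<lambda>t. x + t *\<^sub>R v) \<longlongrightarrow> x) (at_right 0)" by simp
    qed (use x in auto)
    have "((\<lambda>t. t * \<bar>a\<bar> / q) \<longlongrightarrow> 0 * \<bar>a\<bar> / q) (at_right 0)" using q(1) by (intro tendsto_intros) auto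
    then have lim: "((\<lambda>t. t * \<bar>a\<bar> / q) \<longlongrightarrow> 0) (at_right 0)" by simp
    have "\<forall>\<^sub>F t in at_right 0. t * \<bar>a\<bar> / q < d"
      using order_tendstoD(2)[OF lim] d(1) by blast
    moreover have "\<forall>\<^sub>F t in at_right (0::real). 0 < t"
      by (simp add: eventually_at_right_less)
    ultimately show ?thesis using inball[of "cnj u * n"] inball[of "- (cnj u * n)"]
    proof eventually_elim
      case (elim t)
      have quad: "\<bar>a\<bar> < 1 + a\<^sup>2"
      proof -
        have "0 \<le> (\<bar>a\<bar> - 1)\<^sup>2" by simp
        then have "2 * \<bar>a\<bar> \<le> 1 + a\<^sup>2" by (simp add: power2_diff)
        moreover have "0 < 1 + a\<^sup>2" by (simp add: add_pos_nonneg)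
        ultimately show ?thesis by linarith
      qed
      have abs: "\<bar>t * a / q\<bar> = t * \<bar>a\<bar> / q" using elim q by (simp add: abs_mult)
      have key: "t * \<bar>a\<bar> / q < t / q + a * (t * a / q)"
      proof -
        have "t * \<bar>a\<bar> < t * (1 + a\<^sup>2)" using quad elim by simp
        then have "t * \<bar>a\<bar> / q < t * (1 + a\<^sup>2) / q" using q(1) by (rule divide_strict_right_mono)
        then show ?thesis by (simp add: add_divide_distrib power2_eq_square algebra_simps)
      qed
      have plus: "u * (x + t *\<^sub>R (cnj u * n)) = Complex (s0 + t * a / q) (g s0 - t / q)"
        using u by (simp add: distrib_left ux n_def scaleR_conv_of_real mult.left_commute[of u] complex_eq_iff)
      have minus: "u * (x + t *\<^sub>R - (cnj u * n)) = Complex (s0 - t * a / q) (g s0 + t / q)"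
        using u by (simp add: right_diff_distrib ux n_def scaleR_conv_of_real mult.left_commute[of u] complex_eq_iff)
      have "\<bar>g (s0 + t * a / q) - g s0 - a * (t * a / q)\<bar> \<le> t * \<bar>a\<bar> / q"
        using d(2)[of "s0 + t * a / q"] abs elim by simp
      then have "x + t *\<^sub>R (cnj u * n) \<notin> D"
        unfolding D[OF elim(3)] plus complex.sel using key by linarith
      moreover have "\<bar>g (s0 - t * a / q) - g s0 + a * (t * a / q)\<bar> \<le> t * \<bar>a\<bar> / q"
        using d(2)[of "s0 - t * a / q"] abs elim by simp
      then have "x + t *\<^sub>R - (cnj u * n) \<in> D"
        unfolding D[OF elim(4)] minus complex.sel using key by linarith
      ultimately show ?case by blast
    qed
  qed
  have uniq: "N = cnj u * n"
    if N: "norm N = 1" "((\<lambda>y. ((y - x) \<bullet> N) / norm (y - x)) \<longlongrightarrow> 0) (at x within frontier D)"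
      "\<forall>\<^sub>F t in at_right (0::real). x + t *\<^sub>R N \<notin> D" for N
  proof -
    define v where "v = cnj u * Complex 1 a"
    have "isCont \<gamma> s0" unfolding \<gamma>_def
    proof -
      have "isCont g s0" using g by (rule DERIV_isCont)
      then show "isCont (\<lambda>s. cnj u * Complex s (g s)) s0"
        unfolding isCont_def by (intro tendsto_intros tendsto_Complex) auto
    qed
    then have \<gamma>lim: "(\<gamma> \<longlongrightarrow> x) (at s0)" by (simp add: isCont_def x\<gamma>)
    have ne: "\<gamma> s \<noteq> x" if "s \<noteq> s0" for s
      using that u\<gamma>[of s] ux by (metis complex.inject)
    \<comment> \<open>The graph is a curve in the boundary, so the limit may be taken along it.\<close>
    have lim: "filterlim \<gamma> (at x within frontier D) (at s0)"
      unfolding filterlim_at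
    proof
      have "\<forall>\<^sub>F s in at s0. \<gamma> s \<in> ball x0 r"
        using x by (intro topological_tendstoD[OF \<gamma>lim]) auto
      moreover have "\<forall>\<^sub>F s in at s0. s \<noteq> s0" by (simp add: eventually_at_filter)
      ultimately show "\<forall>\<^sub>F s in at s0. \<gamma> s \<in> frontier D \<and> \<gamma> s \<noteq> x"
      proof eventually_elim
        case (elim s)
        then show ?case unfolding frontier[OF elim(1)] u\<gamma> using ne by simp
      qed
    qed (rule \<gamma>lim)
    have quot: "((\<lambda>s. (\<gamma> s - x) /\<^sub>R (s - s0)) \<longlongrightarrow> v) (at s0)"
    proof -
      have "((\<lambda>s. (g s - g s0) / (s - s0)) \<longlongrightarrow> a) (at s0)"
        using g[of s0] by (simp add: has_field_derivative_iff a_def)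
      then have "((\<lambda>s. cnj u * Complex 1 ((g s - g s0) / (s - s0))) \<longlongrightarrow> v) (at s0)"
        unfolding v_def by (intro tendsto_intros tendsto_Complex)
      moreover have "\<forall>\<^sub>F s in at s0. cnj u * Complex 1 ((g s - g s0) / (s - s0)) = (\<gamma> s - x) /\<^sub>R (s - s0)"
        unfolding eventually_at_filter
      proof (intro always_eventually allI impI)
        fix s assume "s \<noteq> s0"
        then have "Complex 1 ((g s - g s0) / (s - s0)) = (Complex s (g s) - Complex s0 (g s0)) /\<^sub>R (s - s0)"
          by (simp add: complex_eq_iff divide_inverse mult.commute)
        then show "cnj u * Complex 1 ((g s - g s0) / (s - s0)) = (\<gamma> s - x) /\<^sub>R (s - s0)"
          by (simp add: x\<gamma> \<gamma>_def right_diff_distrib scaleR_right_diff_distrib)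
      qed
      ultimately show ?thesis by (rule Lim_transform_eventually)
    qed
    have "((\<lambda>s. ((\<gamma> s - x) /\<^sub>R (s - s0)) \<bullet> N) \<longlongrightarrow> v \<bullet> N) (at s0)"
      by (intro tendsto_intros quot)
    then have l1: "((\<lambda>s. \<bar>((\<gamma> s - x) /\<^sub>R (s - s0)) \<bullet> N\<bar>) \<longlongrightarrow> \<bar>v \<bullet> N\<bar>) (at s0)"
      by (rule tendsto_rabs)
    \<comment> \<open>Replacing the normalisation by \<open>norm (\<gamma> s - x)\<close> with \<open>s - s0\<close> costs only the bounded factor
      \<open>norm (\<gamma> s - x) / (s - s0)\<close>, and turns the quotient into a derivative.\<close>
    have "((\<lambda>s. ((\<gamma> s - x) \<bullet> N) / norm (\<gamma> s - x)) \<longlongrightarrow> 0) (at s0)"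
      by (rule filterlim_compose[OF N(2) lim])
    then have "((\<lambda>s. \<bar>((\<gamma> s - x) \<bullet> N) / norm (\<gamma> s - x)\<bar> * norm ((\<gamma> s - x) /\<^sub>R (s - s0))) \<longlongrightarrow> \<bar>0\<bar> * norm v) (at s0)"
      by (intro tendsto_intros quot)
    moreover have "\<forall>\<^sub>F s in at s0. \<bar>((\<gamma> s - x) \<bullet> N) / norm (\<gamma> s - x)\<bar> * norm ((\<gamma> s - x) /\<^sub>R (s - s0))
        = \<bar>((\<gamma> s - x) /\<^sub>R (s - s0)) \<bullet> N\<bar>"
      unfolding eventually_at_filter
      by (intro always_eventually allI impI) (use ne in \<open>simp add: abs_mult divide_inverse\<close>)
    ultimately have "((\<lambda>s. \<bar>((\<gamma> s - x) /\<^sub>R (s - s0)) \<bullet> N\<bar>) \<longlongrightarrow> 0) (at s0)"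
      using Lim_transform_eventually by (simp add: tendsto_cong)
    with l1 have "\<bar>v \<bullet> N\<bar> = 0" using tendsto_unique trivial_limit_at by blast
    moreover have Nu: "N = cnj u * (u * N)" using u by simp
    moreover have "v \<bullet> N = Complex 1 a \<bullet> (u * N)"
      using inner[of N "Complex 1 a"] by (simp add: v_def inner_commute)
    ultimately have "Complex 1 a \<bullet> (u * N) = 0" by simp
    then obtain c where c: "u * N = Complex (- a * c) c"
      by (intro that[of "Im (u * N)"]) (simp add: complex_eq_iff inner_complex_def)
    have "(a * c)\<^sup>2 + c\<^sup>2 = 1"
      using N(1) nu[of N] c by (simp add: complex_norm)
    then have "c\<^sup>2 * q\<^sup>2 = 1" by (simp add: q(2) power_mult_distrib algebra_simps)
    then have "(c * q)\<^sup>2 = 1" by (simp add: power_mult_distrib)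
    then have "c * q = 1 \<or> c * q = - 1" by (simp add: power2_eq_1_iff)
    then have "c = 1 / q \<or> c = - 1 / q" using q(1) by (simp add: field_simps)
    then have "u * N = - n \<or> u * N = n" by (auto simp: c n_def complex_eq_iff)
    then consider "N = cnj u * n" | "N = - (cnj u * n)" using Nu by (metis mult_minus_right)
    then show ?thesis
    proof cases
      case 2
      have "\<forall>\<^sub>F t in at_right (0::real). False"
        using N(3) side unfolding 2 by eventually_elim blast
      then show ?thesis by simp
    qed
  qed
  have "outward_normal D x = cnj u * n"
    unfolding outward_normal_def
  proof (rule the_equality)
    show "norm (cnj u * n) = 1 \<and>
      ((\<lambda>y. ((y - x) \<bullet> (cnj u * n)) / norm (y - x)) \<longlongrightarrow> 0) (at x within frontier D) \<and>
      (\<forall>\<^sub>F t in at_right (0::real). x + t *\<^sub>R (cnj u * n) \<notin> D)"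
      using perp side u n1 by (auto simp: norm_mult elim: eventually_mono)
  qed (use uniq in blast)
  then show ?thesis unfolding s0_def[symmetric] a_def[symmetric] sgn .
qed

section \<open>Invariance of arc length under rotations\<close>

lemma frontier_unit_mult_image:
  fixes w :: complex
  assumes "norm w = 1"
  shows "frontier ((*) w ` S) = (*) w ` frontier S"
proof -
  have lin: "linear ((*) w)" by (rule bounded_linear.linear[OF bounded_linear_mult_right])
  have inj: "inj ((*) w)" using assms by (intro injI) auto
  show ?thesis
    unfolding frontier_def closure_injective_linear_image[OF lin inj, symmetric]
      interior_injective_linear_image[OF lin inj]
    by (rule image_set_diff[OF inj, symmetric])
qed

lemma diameter_unit_mult_image:
  fixes w :: complex
  assumes "norm w = 1"
  shows "diameter ((*) w ` S) = diameter S"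
proof -
  have "(*) w ` S \<times> (*) w ` S = map_prod ((*) w) ((*) w) ` (S \<times> S)" by auto
  moreover have "dist (w * x) (w * y) = dist x y" for x y
    using assms by (simp add: dist_norm norm_mult flip: right_diff_distrib)
  ultimately show ?thesis
    unfolding diameter_def by (simp add: image_image split_def)
qed

text \<open>A rotation maps coverings to coverings with the same diameters, which gives one inequality;
  the other one is the same inequality for the inverse rotation.\<close>

lemma hausdorff1_outer_unit_mult_image:
  assumes "norm w = 1"
  shows "hausdorff1_outer ((*) w ` A) = hausdorff1_outer A"
proof -
  have le: "hausdorff1_outer ((*) v ` B) \<le> hausdorff1_outer B" if "norm v = 1" for v B
    unfolding hausdorff1_outer_def
  proof (rule SUP_mono', unfold hausdorff1_pre_def[of _ B], rule INF_greatest, clarify)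
    fix d :: real and U :: "nat \<Rightarrow> complex set"
    assume U: "B \<subseteq> (\<Union>i. U i)" "\<forall>i. bounded (U i) \<and> diameter (U i) \<le> d"
    have "hausdorff1_pre d ((*) v ` B) \<le> (\<Sum>i. ennreal (diameter ((*) v ` U i)))"
    proof (rule hausdorff1_pre_le)
      show "(*) v ` B \<subseteq> (\<Union>i. (*) v ` U i)" using U(1) by blast
      show "bounded ((*) v ` U i)" for i
        using U(2) bounded_linear_image[OF _ bounded_linear_mult_right] by blast
    qed (use U(2) that in \<open>simp add: diameter_unit_mult_image\<close>)
    then show "hausdorff1_pre d ((*) v ` B) \<le> (\<Sum>i. ennreal (diameter (U i)))"
      using that by (simp add: diameter_unit_mult_image)
  qed
  have "(*) (cnj w) ` (*) w ` A = A" using assms by (simp add: image_image)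
  then show ?thesis using le[of w A] le[of "cnj w" "(*) w ` A"] assms by (simp add: antisym)
qed

lemma sets_hausdorff1 [measurable_cong]: "sets hausdorff1 = sets borel"
  by (simp add: hausdorff1_def sets.sigma_sets_eq[of borel, simplified])

lemma space_hausdorff1: "space hausdorff1 = UNIV"
  by (simp add: hausdorff1_def space_measure_of)

lemma space_arc_length: "space (arc_length D) = frontier D"
  by (simp add: arc_length_def space_restrict_space space_hausdorff1)

lemma sets_arc_length: "sets (arc_length D) = sets (restrict_space borel (frontier D))"
  unfolding arc_length_def by (rule sets_restrict_space_cong[OF sets_hausdorff1])

lemma sets_arc_length_iff: "A \<in> sets (arc_length D) \<longleftrightarrow> A \<in> sets borel \<and> A \<subseteq> frontier D"
  unfolding sets_arc_length by (subst sets_restrict_space_iff) auto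

lemma borel_measurable_arc_length:
  fixes f :: "complex \<Rightarrow> complex"
  assumes "f \<in> borel_measurable borel"
  shows "f \<in> borel_measurable (arc_length D)"
  using measurable_restrict_space1[OF assms] measurable_cong_sets[OF sets_arc_length refl] by blast

lemma emeasure_arc_length:
  assumes "A \<in> sets (arc_length D)"
  shows "emeasure (arc_length D) A = hausdorff1_outer A"
proof -
  have "A \<in> sets borel" "A \<subseteq> frontier D" using assms sets_arc_length_iff by auto
  then show ?thesis unfolding arc_length_def
    by (subst emeasure_restrict_space) (auto simp: sets_hausdorff1 space_hausdorff1 emeasure_hausdorff1)
qed

lemma frontier_rotation_iff:
  fixes w :: complex
  assumes "norm w = 1" "(*) w ` D = D"
  shows "w * x \<in> frontier D \<longleftrightarrow> x \<in> frontier D"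
proof -
  have "frontier D = (*) w ` frontier D" using frontier_unit_mult_image[OF assms(1), of D] assms(2) by simp
  moreover have "inj ((*) w)" using assms(1) by (intro injI) auto
  ultimately show ?thesis by (metis inj_image_mem_iff)
qed

lemma measurable_rotation_arc_length:
  assumes "norm w = 1" "(*) w ` D = D"
  shows "(*) w \<in> measurable (arc_length D) (arc_length D)"
proof -
  have "(*) w \<in> measurable (restrict_space borel (frontier D)) (restrict_space borel (frontier D))"
    by (rule measurable_restrict_space3) (auto simp: frontier_rotation_iff[OF assms])
  then show ?thesis using measurable_cong_sets[OF sets_arc_length sets_arc_length] by blast
qed

lemma distr_rotation_arc_length:
  assumes "norm w = 1" "(*) w ` D = D"
  shows "distr (arc_length D) (arc_length D) ((*) w) = arc_length D"
proof (rule measure_eqI)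
  fix A assume "A \<in> sets (distr (arc_length D) (arc_length D) ((*) w))"
  then have A: "A \<in> sets (arc_length D)" by simp
  let ?B = "(*) w -` A \<inter> space (arc_length D)"
  have B: "?B \<in> sets (arc_length D)"
    using measurable_rotation_arc_length[OF assms] A by (rule measurable_sets)
  have "(*) w ` ?B = A"
  proof
    show "A \<subseteq> (*) w ` ?B"
    proof
      fix y assume y: "y \<in> A"
      then have "y \<in> frontier D" using A sets_arc_length_iff by blast
      then have "cnj w * y \<in> ?B"
        using y assms frontier_rotation_iff[OF assms, of "cnj w * y"] by (simp add: space_arc_length)
      then show "y \<in> (*) w ` ?B" using assms(1) by (intro image_eqI[of _ _ "cnj w * y"]) auto
    qed
  qed auto
  then show "emeasure (distr (arc_length D) (arc_length D) ((*) w)) A = emeasure (arc_length D) A"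
    using hausdorff1_outer_unit_mult_image[OF assms(1), of ?B] A B
    by (simp add: emeasure_distr measurable_rotation_arc_length[OF assms] emeasure_arc_length)
qed simp

lemma integral_rotation_arc_length:
  fixes h :: "complex \<Rightarrow> complex"
  assumes "norm w = 1" "(*) w ` D = D" "h \<in> borel_measurable (arc_length D)"
  shows "(LINT y|arc_length D. h (w * y)) = (LINT y|arc_length D. h y)"
  using integral_distr[OF measurable_rotation_arc_length[OF assms(1,2)] assms(3)]
  by (simp add: distr_rotation_arc_length[OF assms(1,2)])

section \<open>The normal field of a domain with twice differentiable boundary\<close>

lemma C2_boundaryE:
  assumes "C2_boundary D" "x \<in> frontier D"
  obtains r u g g' where "r > 0" "graph_chart D x r u g"
    "\<And>s. (g has_real_derivative g' s) (at s)" "continuous_on UNIV g'"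
proof -
  obtain r u g where r: "r > 0" "norm u = 1" "C2_function g"
      "D \<inter> ball x r = {y \<in> ball x r. g (Re (u * y)) < Im (u * y)}"
    using assms unfolding C2_boundary_def by blast
  moreover obtain g' g'' where g: "\<And>s. (g has_real_derivative g' s) (at s)"
      "\<And>s. (g' has_real_derivative g'' s) (at s)"
    using r(3) unfolding C2_function_def by blast
  ultimately show ?thesis
    by (intro that[of r u g g']) (auto simp: graph_chart_def intro!: continuous_at_imp_continuous_on DERIV_isCont)
qed

text \<open>The rotated chart keeps the function \<open>g\<close>; this is what makes normals equivariant
  without comparing limits at different boundary points.\<close>

lemma graph_chart_rotate:
  assumes "norm w = 1" "(*) w ` D = D" "graph_chart D x0 r u g"
  shows "graph_chart D (w * x0) r (u * cnj w) g"
  unfolding graph_chart_def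
proof
  show "norm (u * cnj w) = 1" using assms graph_chartD(1) by (simp add: norm_mult)
  have "w * y \<in> D \<longleftrightarrow> y \<in> D" for y
  proof
    assume "w * y \<in> D"
    then obtain z where "z \<in> D" "w * z = w * y" using assms(2) by (metis imageE)
    moreover have "w \<noteq> 0" using assms(1) by auto
    ultimately show "y \<in> D" by simp
  qed (use assms(2) in blast)
  moreover have "w * y \<in> ball (w * x0) r \<longleftrightarrow> y \<in> ball x0 r" for y
    using assms(1) by (simp add: dist_norm norm_mult flip: right_diff_distrib)
  ultimately have "w * y \<in> D \<inter> ball (w * x0) r \<longleftrightarrow>
      w * y \<in> ball (w * x0) r \<and> g (Re (u * y)) < Im (u * y)" for y
    using graph_chartD(2)[OF assms(3)] by blast
  then have "y \<in> D \<inter> ball (w * x0) r \<longleftrightarrow>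
      y \<in> ball (w * x0) r \<and> g (Re (u * (cnj w * y))) < Im (u * (cnj w * y))" for y
    using unit_mult_cnj_left(1)[OF assms(1)] by metis
  then show "D \<inter> ball (w * x0) r = {x \<in> ball (w * x0) r. g (Re (u * cnj w * x)) < Im (u * cnj w * x)}"
    by (simp add: set_eq_iff mult.assoc)
qed

text \<open>Evaluate the normal at \<open>w x\<close> in the rotated chart: both points have the same abscissa, so
  the two formulas differ only in the frame factor.\<close>

lemma outward_normal_rotation:
  assumes "open D" "C2_boundary D" "norm w = 1" "(*) w ` D = D" "x \<in> frontier D"
  shows "outward_normal D (w * x) = w * outward_normal D x"
proof -
  obtain r u g g' where c: "r > 0" "graph_chart D x r u g"
      "\<And>s. (g has_real_derivative g' s) (at s)"
    by (rule C2_boundaryE[OF assms(2,5)]) blast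
  have "outward_normal D (w * x) =
      cnj (u * cnj w) * (- \<i> * sgn (Complex 1 (g' (Re (u * cnj w * (w * x))))))"
    by (rule outward_normal_graph_chart[OF assms(1) graph_chart_rotate[OF assms(3,4) c(2)] c(3)])
      (use assms(5) c(1) frontier_rotation_iff[OF assms(3,4)] in auto)
  moreover have arg: "u * cnj w * (w * x) = u * x" using assms(3) by (simp add: mult.assoc)
  ultimately show ?thesis
    unfolding arg outward_normal_graph_chart[OF assms(1) c(2,3) centre_in_ball[THEN iffD2, OF c(1)] assms(5)]
    by (simp only: complex_cnj_mult complex_cnj_cnj mult_ac)
qed

lemma norm_outward_normal:
  assumes "open D" "C2_boundary D" "x \<in> frontier D"
  shows "norm (outward_normal D x) = 1"
proof -
  obtain r u g g' where c: "r > 0" "graph_chart D x r u g"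
      "\<And>s. (g has_real_derivative g' s) (at s)"
    by (rule C2_boundaryE[OF assms(2,3)]) blast
  have "Complex 1 t \<noteq> 0" for t by (simp add: complex_eq_iff)
  then show ?thesis using graph_chartD(1)[OF c(2)]
    unfolding outward_normal_graph_chart[OF assms(1) c(2,3) centre_in_ball[THEN iffD2, OF c(1)] assms(3)]
    by (simp add: norm_mult norm_sgn)
qed

lemma continuous_on_outward_normal:
  assumes "open D" "C2_boundary D"
  shows "continuous_on (frontier D) (outward_normal D)"
  unfolding continuous_on_eq_continuous_within
proof
  fix x assume x: "x \<in> frontier D"
  obtain r u g g' where c: "r > 0" "graph_chart D x r u g"
      "\<And>s. (g has_real_derivative g' s) (at s)" "continuous_on UNIV g'"
    by (rule C2_boundaryE[OF assms(2) x]) blast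
  define h where "h y = cnj u * (- \<i> * sgn (Complex 1 (g' (Re (u * y)))))" for y
  have "continuous_on UNIV (\<lambda>y. g' (Re (u * y)))"
    by (rule continuous_on_compose2[OF c(4)]) (auto intro!: continuous_intros)
  then have "continuous_on UNIV h" unfolding h_def
    by (intro continuous_intros continuous_on_Complex) (auto simp: complex_eq_iff)
  then have "continuous (at x within frontier D) h"
    by (meson UNIV_I continuous_at_imp_continuous_at_within continuous_on_eq_continuous_at open_UNIV)
  moreover have "h y = outward_normal D y" if "y \<in> frontier D" "dist y x < r" for y
    unfolding h_def
    by (rule outward_normal_graph_chart[OF assms(1) c(2,3), symmetric]) (use that in \<open>auto simp: dist_commute\<close>)
  ultimately show "continuous (at x within frontier D) (outward_normal D)"
    by (rule continuous_transform_within[OF _ c(1) x])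
qed

lemma measurable_outward_normal:
  assumes "open D" "C2_boundary D"
  shows "outward_normal D \<in> borel_measurable (arc_length D)"
  using borel_measurable_continuous_on_restrict[OF continuous_on_outward_normal[OF assms]]
    measurable_cong_sets[OF sets_arc_length refl] by blast

section \<open>Finiteness of arc length\<close>

text \<open>Cut the parameter interval into \<open>N\<close> equal pieces. Their images have diameter at most
  \<open>L (b - a) / N\<close>, which is as small as required, while the sum of these bounds is independent
  of \<open>N\<close>.\<close>

lemma hausdorff1_outer_lipschitz_arc:
  fixes \<gamma> :: "real \<Rightarrow> complex"
  assumes "a \<le> b" "0 \<le> L"
    and lip: "\<And>s t. s \<in> {a..b} \<Longrightarrow> t \<in> {a..b} \<Longrightarrow> norm (\<gamma> s - \<gamma> t) \<le> L * \<bar>s - t\<bar>"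
  shows "hausdorff1_outer (\<gamma> ` {a..b}) \<le> ennreal (L * (b - a))"
  unfolding hausdorff1_outer_def
proof (rule SUP_least)
  fix d :: real assume "d \<in> {0<..}"
  then have d: "d > 0" by simp
  obtain N :: nat where N: "L * (b - a) / d < real N" using reals_Archimedean2 by blast
  moreover have "0 \<le> L * (b - a) / d" using assms d by simp
  ultimately have N0: "0 < real N" by linarith
  define h where "h = (b - a) / real N"
  have h: "0 \<le> h" "real N * h = b - a" using assms N0 by (simp_all add: h_def)
  have "L * (b - a) < d * real N" using N d by (simp add: divide_less_eq mult.commute)
  then have Lh: "L * h \<le> d" using N0 by (simp add: h_def divide_le_eq)
  define I where "I i = {a + real i * h .. a + real (Suc i) * h}" for i
  have cover: "{a..a + real n * h} \<subseteq> (\<Union>i<n. I i)" if "0 < n" for n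
    using that
  proof (induction n)
    case (Suc n)
    have "{a..a + real (Suc n) * h} \<subseteq> {a..a + real n * h} \<union> I n"
      unfolding I_def by auto
    moreover have "{a..a + real n * h} \<subseteq> (\<Union>i<n. I i) \<union> I n"
      using Suc h(1) by (cases "n = 0") (auto simp: I_def)
    ultimately show ?case by (auto simp: lessThan_Suc)
  qed simp
  have Isub: "I i \<subseteq> {a..b}" if "i < N" for i
  proof -
    have "real (Suc i) * h \<le> real N * h" using that h(1) by (intro mult_right_mono) auto
    moreover have "0 \<le> real i * h" using h(1) by simp
    ultimately show ?thesis using h(2) by (auto simp: I_def)
  qed
  define U where "U i = (if i < N then \<gamma> ` I i else {})" for i
  have dist: "norm (x - y) \<le> L * h" if "x \<in> U i" "y \<in> U i" for x y i
  proof -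
    obtain s t where st: "i < N" "s \<in> I i" "t \<in> I i" "x = \<gamma> s" "y = \<gamma> t"
      using \<open>x \<in> U i\<close> \<open>y \<in> U i\<close> by (auto simp: U_def split: if_splits)
    have "\<bar>s - t\<bar> \<le> h" using st(2,3) by (auto simp: I_def distrib_right)
    then have "L * \<bar>s - t\<bar> \<le> L * h" using assms(2) by (rule mult_left_mono)
    then show ?thesis using lip[of s t] Isub[OF st(1)] st by force
  qed
  have diam: "diameter (U i) \<le> L * h" for i
    using dist h(1) assms(2) by (intro diameter_le) auto
  have "hausdorff1_pre d (\<gamma> ` {a..b}) \<le> (\<Sum>i. ennreal (diameter (U i)))"
  proof (rule hausdorff1_pre_le)
    have "{a..b} \<subseteq> (\<Union>i<N. I i)" using cover[of N] N0 h(2) by simp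
    then show "\<gamma> ` {a..b} \<subseteq> (\<Union>i. U i)" by (fastforce simp: U_def)
    show "diameter (U i) \<le> d" for i using diam Lh by (rule order_trans)
    show "bounded (U i)" for i
      unfolding bounded_two_points dist_norm using dist by blast
  qed
  also have "\<dots> = (\<Sum>i<N. ennreal (diameter (U i)))"
    by (intro suminf_finite) (auto simp: U_def)
  also have "\<dots> \<le> (\<Sum>i<N. ennreal (L * h))"
    by (intro sum_mono ennreal_leI diam)
  also have "\<dots> = ennreal (real N * (L * h))"
    using h(1) assms(2) by (simp add: ennreal_of_nat_eq_real_of_nat ennreal_mult)
  also have "real N * (L * h) = L * (b - a)"
    using h(2) by (simp add: mult.left_commute[of _ L])
  finally show "hausdorff1_pre d (\<gamma> ` {a..b}) \<le> ennreal (L * (b - a))" .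
qed

lemma hausdorff1_outer_frontier_chart_finite:
  assumes "open D" and chart: "graph_chart D x0 r u g"
    and g: "\<And>s. (g has_real_derivative g' s) (at s)" and g': "continuous_on UNIV g'"
  shows "hausdorff1_outer (frontier D \<inter> ball x0 r) < \<infinity>"
proof (cases "r > 0")
  case True
  have u: "norm u = 1" by (rule graph_chartD(1)[OF chart])
  have cont: "continuous_on UNIV g"
    using g by (meson DERIV_isCont continuous_at_imp_continuous_on)
  define a where "a = Re (u * x0) - r"
  define b where "b = Re (u * x0) + r"
  have "bounded (g' ` {a..b})"
    using g' by (intro compact_imp_bounded compact_continuous_image) (auto intro: continuous_on_subset)
  then obtain K where K: "K > 0" "\<And>s. s \<in> {a..b} \<Longrightarrow> \<bar>g' s\<bar> \<le> K"
    by (auto simp: bounded_pos)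
  define \<gamma> where "\<gamma> = (\<lambda>s. cnj u * Complex s (g s))"
  have lip: "norm (\<gamma> s - \<gamma> t) \<le> (1 + K) * \<bar>s - t\<bar>" if "s \<in> {a..b}" "t \<in> {a..b}" for s t
  proof -
    have "norm (g s - g t) \<le> K * norm (s - t)"
      by (rule field_differentiable_bound[of "{a..b}" g g'])
        (use that K has_field_derivative_at_within[OF g] in auto)
    moreover have "norm (\<gamma> s - \<gamma> t) = norm (Complex (s - t) (g s - g t))"
      using u by (simp add: \<gamma>_def norm_mult complex_diff flip: right_diff_distrib)
    moreover have "\<dots> \<le> \<bar>s - t\<bar> + \<bar>g s - g t\<bar>"
      using cmod_le[of "Complex (s - t) (g s - g t)"] by simp
    ultimately show ?thesis by (simp add: distrib_right)
  qed
  have "frontier D \<inter> ball x0 r \<subseteq> \<gamma> ` {a..b}"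
  proof
    fix x assume x: "x \<in> frontier D \<inter> ball x0 r"
    then have "g (Re (u * x)) = Im (u * x)"
      using frontier_graph_chart[OF assms(1) chart cont] by blast
    then have "x = \<gamma> (Re (u * x))" using u by (simp only: \<gamma>_def complex_surj unit_mult_cnj_left)
    moreover have "\<bar>Re (u * x) - Re (u * x0)\<bar> \<le> r"
    proof -
      have "\<bar>Re (u * (x - x0))\<bar> \<le> norm (u * (x - x0))" by (rule abs_Re_le_cmod)
      also have "\<dots> = norm (x - x0)" using u by (simp add: norm_mult)
      also have "\<dots> \<le> r" using x by (simp add: dist_norm norm_minus_commute)
      finally show ?thesis by (simp only: right_diff_distrib minus_complex.sel)
    qed
    then have "Re (u * x) \<in> {a..b}" unfolding a_def b_def atLeastAtMost_iff by linarith
    ultimately show "x \<in> \<gamma> ` {a..b}" by (rule image_eqI)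
  qed
  then have "hausdorff1_outer (frontier D \<inter> ball x0 r) \<le> hausdorff1_outer (\<gamma> ` {a..b})"
    by (rule hausdorff1_outer_mono)
  also have "\<dots> \<le> ennreal ((1 + K) * (b - a))"
    by (rule hausdorff1_outer_lipschitz_arc) (use True K lip in \<open>auto simp: a_def b_def\<close>)
  also have "\<dots> < \<infinity>" by simp
  finally show ?thesis .
qed (simp add: ball_empty hausdorff1_outer_empty)

text \<open>Compactness of the boundary reduces the claim to finitely many charts. Finiteness is what
  puts bounded functions, and so the Neumann data of polynomials, into \<open>L\<^sup>2\<close>.\<close>

lemma finite_measure_arc_length:
  assumes "open D" "bounded D" "C2_boundary D"
  shows "finite_measure (arc_length D)"
proof (rule finite_measureI)
  have "\<exists>r>0. hausdorff1_outer (frontier D \<inter> ball x r) < \<infinity>" if fr: "x \<in> frontier D" for x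
  proof -
    obtain r u g g' where c: "r > 0" "graph_chart D x r u g"
        "\<And>s. (g has_real_derivative g' s) (at s)" "continuous_on UNIV g'"
      by (rule C2_boundaryE[OF assms(3) fr]) blast
    then show ?thesis using hausdorff1_outer_frontier_chart_finite[OF assms(1) c(2-4)] by blast
  qed
  then obtain r where r: "\<And>x. x \<in> frontier D \<Longrightarrow> 0 < r x"
      "\<And>x. x \<in> frontier D \<Longrightarrow> hausdorff1_outer (frontier D \<inter> ball x (r x)) < \<infinity>"
    by metis
  have "compact (frontier D)" using assms(2) by (rule compact_frontier_bounded)
  then obtain S where S: "S \<subseteq> frontier D" "finite S" "frontier D \<subseteq> (\<Union>x\<in>S. ball x (r x))"
    by (rule compactE_image[of _ "frontier D" "\<lambda>x. ball x (r x)"]) (use r(1) in force)+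
  have "hausdorff1_outer (\<Union>x\<in>S. frontier D \<inter> ball x (r x)) < \<infinity>"
    using S(2,1)
  proof (induction S rule: finite_induct)
    case (insert x S)
    have "hausdorff1_outer (\<Union>x\<in>insert x S. frontier D \<inter> ball x (r x)) \<le>
        hausdorff1_outer (frontier D \<inter> ball x (r x)) + hausdorff1_outer (\<Union>x\<in>S. frontier D \<inter> ball x (r x))"
      unfolding UN_insert by (rule hausdorff1_outer_Un_le)
    also have "\<dots> < \<infinity>" using insert r(2) by (simp add: ennreal_add_less_top)
    finally show ?case .
  qed (simp add: hausdorff1_outer_empty)
  moreover have "frontier D = (\<Union>x\<in>S. frontier D \<inter> ball x (r x))" using S(3) by blast
  ultimately have "hausdorff1_outer (frontier D) < \<infinity>" by simp
  then show "emeasure (arc_length D) (space (arc_length D)) \<noteq> \<infinity>"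
    unfolding emeasure_arc_length[OF sets.top] unfolding space_arc_length by auto
qed

section \<open>Neumann data of the complex monomials\<close>

lemma cpoly_eq_power: "cpoly m x = x ^ m"
  by (simp add: cpoly_def complex_eq[symmetric])

lemma has_vector_derivative_cpoly:
  "((\<lambda>t. cpoly m (x + v * of_real t)) has_vector_derivative v * (of_nat m * x ^ (m - 1))) (at 0)"
proof -
  have "((\<lambda>z. (x + v * z) ^ m) has_field_derivative v * (of_nat m * x ^ (m - 1))) (at (of_real 0))"
    by (auto intro!: derivative_eq_intros)
  then show ?thesis unfolding cpoly_eq_power by (rule has_vector_derivative_real_field)
qed

lemma normal_derivative_cpoly:
  "normal_derivative D (cpoly m) x = outward_normal D x * (of_nat m * x ^ (m - 1))"
proof -
  note d = has_vector_derivative_cpoly[THEN vector_derivative_at]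
  have "complex_of_real (Re \<nu>) * z + complex_of_real (Im \<nu>) * (\<i> * z) = \<nu> * z" for \<nu> z
    by (simp add: complex_eq_iff algebra_simps)
  then show ?thesis
    using d[of m x 1] d[of m x \<i>]
    by (simp add: normal_derivative_def partial1_def partial2_def)
qed

lemma normal_derivative_cnj_cpoly:
  "normal_derivative D (\<lambda>x. cnj (cpoly m x)) x = cnj (normal_derivative D (cpoly m) x)"
proof -
  note d = has_vector_derivative_cpoly[THEN vector_derivative_at]
  note d' = has_vector_derivative_cpoly[THEN bounded_linear.has_vector_derivative[OF bounded_linear_cnj],
      THEN vector_derivative_at]
  show ?thesis
    using d[of m x 1] d[of m x \<i>] d'[of m x 1] d'[of m x \<i>]
    by (simp add: normal_derivative_def partial1_def partial2_def)
qed

section \<open>Symmetry of the Neumann--Poincare operator and its resolvent\<close>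

text \<open>The kernel is built from inner products and distances, so it is unchanged when both
  points and the normal are rotated; the rest is the change of variables \<open>y \<mapsto> w y\<close>.\<close>

lemma NP_operator_rotation:
  assumes "open D" "C2_boundary D" and w: "norm w = 1" "(*) w ` D = D"
    and "\<phi> \<in> borel_measurable (arc_length D)" "x \<in> frontier D"
  shows "NP_operator D (\<lambda>y. \<phi> (w * y)) x = NP_operator D \<phi> (w * x)"
proof -
  define k where "k y = complex_of_real (((w * x - y) \<bullet> outward_normal D (w * x)) / (norm (w * x - y))\<^sup>2)" for y
  have "k \<in> borel_measurable borel" unfolding k_def by measurable
  then have "(\<lambda>y. k y * \<phi> y) \<in> borel_measurable (arc_length D)"
    using borel_measurable_times[OF borel_measurable_arc_length assms(5)] by blast
  note int = integral_rotation_arc_length[OF w this]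
  have inner: "(w * a) \<bullet> (w * b) = a \<bullet> b" for a b
  proof -
    have "(w * a) \<bullet> (w * b) = ((Re w)\<^sup>2 + (Im w)\<^sup>2) * (a \<bullet> b)"
      by (simp add: inner_complex_def power2_eq_square algebra_simps)
    also have "(Re w)\<^sup>2 + (Im w)\<^sup>2 = 1" using cmod_power2[of w] w(1) by simp
    finally show ?thesis by simp
  qed
  have "k (w * y) = complex_of_real (((x - y) \<bullet> outward_normal D x) / (norm (x - y))\<^sup>2)" for y
    unfolding k_def outward_normal_rotation[OF assms(1-4,6)]
    using w(1) by (simp add: inner norm_mult flip: right_diff_distrib)
  then show ?thesis using int unfolding NP_operator_def k_def[symmetric] by simp
qed

lemma L2_rotation:
  assumes w: "norm w = 1" "(*) w ` D = D" and "\<phi> \<in> L2 (arc_length D)"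
  shows "(\<lambda>y. \<phi> (w * y)) \<in> L2 (arc_length D)"
proof -
  note m = measurable_rotation_arc_length[OF w]
  have \<phi>: "\<phi> \<in> borel_measurable (arc_length D)" "integrable (arc_length D) (\<lambda>x. (norm (\<phi> x))\<^sup>2)"
    using assms(3) by (auto simp: L2_def)
  have "integrable (distr (arc_length D) (arc_length D) ((*) w)) (\<lambda>x. (norm (\<phi> x))\<^sup>2)"
    using \<phi>(2) by (simp add: distr_rotation_arc_length[OF w])
  then have "integrable (arc_length D) (\<lambda>x. (norm (\<phi> (w * x)))\<^sup>2)"
    by (rule integrable_distr[OF m])
  then show ?thesis using measurable_compose[OF m \<phi>(1)] by (simp add: L2_def)
qed

lemma AE_rotation:
  assumes w: "norm w = 1" "(*) w ` D = D" and "AE x in arc_length D. P x"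
  shows "AE x in arc_length D. P (w * x)"
  using assms(3) AE_distrD[OF measurable_rotation_arc_length[OF w], of P]
  unfolding distr_rotation_arc_length[OF w] by blast

lemma L2_cmult: "\<phi> \<in> L2 M \<Longrightarrow> (\<lambda>y. c * \<phi> y) \<in> L2 M"
  by (auto simp: L2_def norm_mult power_mult_distrib)

text \<open>The resolvent inherits the symmetry of its argument from uniqueness: if \<open>T \<phi> = f\<close>, then the
  rotated function \<open>\<phi> (w x)\<close> and the multiple \<open>c \<phi>(x)\<close> have the same image under \<open>T\<close>.\<close>

lemma NP_resolvent_rotation:
  assumes "open D" "C2_boundary D" and w: "norm w = 1" "(*) w ` D = D"
    and f: "f \<in> L2 (arc_length D)" and eq: "\<forall>x\<in>frontier D. f (w * x) = c * f x"
    and inv: "L2_invertible (arc_length D) (\<lambda>\<phi> x. complex_of_real lam * \<phi> x - NP_operator D \<phi> x)"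
  shows "NP_resolvent lam D f \<in> L2 (arc_length D)"
    and "AE x in arc_length D. NP_resolvent lam D f (w * x) = c * NP_resolvent lam D f x"
proof -
  let ?M = "arc_length D"
  define T where "T = (\<lambda>\<phi> x. complex_of_real lam * \<phi> x - NP_operator D \<phi> x)"
  define \<phi> where "\<phi> = NP_resolvent lam D f"
  note inv = inv[folded T_def]
  have ex: "\<exists>\<phi>. \<phi> \<in> L2 ?M \<and> (AE x in ?M. T \<phi> x = f x)"
    using inv f unfolding L2_invertible_def by blast
  have "\<phi> = (SOME \<phi>. \<phi> \<in> L2 ?M \<and> (AE x in ?M. T \<phi> x = f x))"
    unfolding \<phi>_def NP_resolvent_def L2_inverse_def T_def[symmetric] using inv by simp
  then have \<phi>: "\<phi> \<in> L2 ?M \<and> (AE x in ?M. T \<phi> x = f x)"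
    using someI_ex[OF ex] by simp
  then show "NP_resolvent lam D f \<in> L2 ?M" by (simp add: \<phi>_def)
  have meas: "\<phi> \<in> borel_measurable ?M" using \<phi> by (simp add: L2_def)
  have rot: "T (\<lambda>y. \<phi> (w * y)) x = T \<phi> (w * x)" if "x \<in> frontier D" for x
    unfolding T_def using NP_operator_rotation[OF assms(1,2) w meas that] by simp
  have "NP_operator D (\<lambda>y. c * \<phi> y) x = c * NP_operator D \<phi> x" for x
    unfolding NP_operator_def by (simp only: mult.left_commute[of _ c] integral_mult_right_zero)
  then have scale: "T (\<lambda>y. c * \<phi> y) x = c * T \<phi> x" for x
    unfolding T_def by (simp add: right_diff_distrib mult.left_commute[of _ c])
  have fr: "AE x in ?M. x \<in> frontier D" by (rule AE_I2) (simp add: space_arc_length)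
  have "AE x in ?M. T \<phi> (w * x) = f (w * x)" using AE_rotation[OF w] \<phi> by blast
  moreover have "AE x in ?M. T \<phi> x = f x" using \<phi> by blast
  ultimately have "AE x in ?M. T (\<lambda>y. \<phi> (w * y)) x = T (\<lambda>y. c * \<phi> y) x"
    using fr by eventually_elim (simp add: rot scale eq)
  moreover have "AE x in ?M. \<alpha> x = \<beta> x"
    if "\<alpha> \<in> L2 ?M" "\<beta> \<in> L2 ?M" "AE x in ?M. T \<alpha> x = T \<beta> x" for \<alpha> \<beta>
    using inv that unfolding L2_invertible_def by blast
  ultimately have "AE x in ?M. \<phi> (w * x) = c * \<phi> x"
    using L2_rotation[OF w] L2_cmult \<phi> by blast
  then show "AE x in ?M. NP_resolvent lam D f (w * x) = c * NP_resolvent lam D f x"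
    by (simp add: \<phi>_def)
qed

text \<open>Rotating the variable of integration multiplies the integral by \<open>w^n c\<close>, so it vanishes
  when this factor is not \<open>1\<close>. If the operator is not invertible, the resolvent is zero by
  convention and so is the integral.\<close>

lemma moment_NP_resolvent_eq_0:
  assumes "open D" "C2_boundary D" and w: "norm w = 1" "(*) w ` D = D"
    and f: "f \<in> L2 (arc_length D)" and eq: "\<forall>x\<in>frontier D. f (w * x) = c * f x"
    and ne: "w ^ n * c \<noteq> 1"
  shows "(LINT y|arc_length D. cpoly n y * NP_resolvent lam D f y) = 0"
proof (cases "L2_invertible (arc_length D) (\<lambda>\<phi> x. complex_of_real lam * \<phi> x - NP_operator D \<phi> x)")
  case True
  define \<phi> where "\<phi> = NP_resolvent lam D f"
  note res = NP_resolvent_rotation[OF assms(1-2) w f eq True, folded \<phi>_def]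
  have "\<phi> \<in> borel_measurable (arc_length D)" using res(1) by (simp add: L2_def)
  then have meas: "(\<lambda>y. y ^ n * \<phi> y) \<in> borel_measurable (arc_length D)"
    by (rule borel_measurable_times[OF borel_measurable_arc_length, rotated]) simp
  let ?I = "LINT y|arc_length D. y ^ n * \<phi> y"
  have "?I = (LINT y|arc_length D. (w * y) ^ n * \<phi> (w * y))"
    by (rule integral_rotation_arc_length[OF w meas, symmetric])
  also have "\<dots> = (LINT y|arc_length D. (w ^ n * c) * (y ^ n * \<phi> y))"
  proof (rule integral_cong_AE)
    show "(\<lambda>y. (w * y) ^ n * \<phi> (w * y)) \<in> borel_measurable (arc_length D)"
      by (rule measurable_compose[OF measurable_rotation_arc_length[OF w] meas])
    show "AE y in arc_length D. (w * y) ^ n * \<phi> (w * y) = w ^ n * c * (y ^ n * \<phi> y)"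
      using res(2) by eventually_elim (simp add: power_mult_distrib)
  qed (rule borel_measurable_times[OF borel_measurable_const meas])
  also have "\<dots> = (w ^ n * c) * ?I" by simp
  finally have "(1 - w ^ n * c) * ?I = 0" by (simp add: algebra_simps)
  then show ?thesis using ne by (simp add: cpoly_eq_power \<phi>_def)
qed (simp add: NP_resolvent_def L2_inverse_def)

section \<open>Vanishing of the polarization tensors\<close>

lemma integrable_bounded_arc_length:
  fixes f :: "complex \<Rightarrow> 'a::{banach, second_countable_topology}"
  assumes "finite_measure (arc_length D)" "f \<in> borel_measurable (arc_length D)"
    and "\<And>x. x \<in> frontier D \<Longrightarrow> norm (f x) \<le> B"
  shows "integrable (arc_length D) f"
  by (rule finite_measure.integrable_const_bound[OF assms(1), of _ B])
    (use assms(2,3) in \<open>auto simp: space_arc_length intro!: AE_I2\<close>)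

lemma normal_derivative_cpoly_L2:
  assumes "open D" "bounded D" "C2_boundary D"
  shows "normal_derivative D (cpoly m) \<in> L2 (arc_length D)"
proof -
  let ?f = "normal_derivative D (cpoly m)"
  have meas: "?f \<in> borel_measurable (arc_length D)"
    unfolding normal_derivative_cpoly
    by (rule borel_measurable_times[OF measurable_outward_normal[OF assms(1,3)] borel_measurable_arc_length]) simp
  obtain R where R: "R > 0" "\<And>x. x \<in> frontier D \<Longrightarrow> norm x \<le> R"
    using compact_imp_bounded[OF compact_frontier_bounded[OF assms(2)]] by (auto simp: bounded_pos)
  have "(norm (?f x))\<^sup>2 \<le> (real m * R ^ (m - 1))\<^sup>2" if "x \<in> frontier D" for x
    unfolding normal_derivative_cpoly norm_mult norm_outward_normal[OF assms(1,3) that] norm_power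
    using R(2)[OF that] by (intro power_mono) (auto intro!: mult_left_mono power_mono)
  then have "integrable (arc_length D) (\<lambda>x. (norm (?f x))\<^sup>2)"
    using meas by (intro integrable_bounded_arc_length[OF finite_measure_arc_length[OF assms]]) auto
  then show ?thesis using meas by (simp add: L2_def)
qed

text \<open>The normal contributes one factor \<open>w\<close> and the complex derivative \<open>m x^(m-1)\<close> the other
  \<open>m - 1\<close>.\<close>

lemma normal_derivative_cpoly_rotation:
  assumes "open D" "C2_boundary D" "norm w = 1" "(*) w ` D = D" "x \<in> frontier D" "m \<ge> 1"
  shows "normal_derivative D (cpoly m) (w * x) = w ^ m * normal_derivative D (cpoly m) x"
  unfolding normal_derivative_cpoly outward_normal_rotation[OF assms(1-5)]
  using power_Suc[of w "m - 1"] assms(6) by (simp add: power_mult_distrib mult_ac)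

lemma root_of_unity_power_eq_1:
  assumes "p \<ge> 1"
  shows "exp (2 * complex_of_real pi * \<i> / of_nat p) ^ k = 1 \<longleftrightarrow> p dvd k"
  using complex_root_unity_eq_1[of p k] assms
  by (simp add: exp_of_nat_mult[symmetric] mult_ac)

theorem proposition4p3:
  fixes \<kappa> :: real and D :: "complex set" and p :: nat
  assumes "\<kappa> > 1"
    and "bounded_C2_domain D"
    and "p \<ge> 2"
    and "(\<lambda>x. exp (2 * complex_of_real pi * \<i> / of_nat p) * x) ` D = D"
  shows "\<forall>m\<ge>1. \<forall>n\<ge>1.
    (\<not> p dvd m + n \<longrightarrow> CGPT1 (contrast \<kappa>) D m n = 0) \<and>
    (\<not> int p dvd int m - int n \<longrightarrow> CGPT2 (contrast \<kappa>) D m n = 0)"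
proof (intro allI impI conjI)
  fix m n :: nat assume m: "m \<ge> 1"
  define w where "w = exp (2 * complex_of_real pi * \<i> / of_nat p)"
  have w: "norm w = 1" "(*) w ` D = D"
    using assms(4) by (simp_all add: w_def norm_exp_eq_Re)
  have unity: "w ^ k = 1 \<longleftrightarrow> p dvd k" for k
    unfolding w_def by (rule root_of_unity_power_eq_1) (use assms(3) in simp)
  have D: "open D" "C2_boundary D" "bounded D"
    using assms(2) by (auto simp: bounded_C2_domain_def)
  let ?f = "normal_derivative D (cpoly m)"
  note f = normal_derivative_cpoly_L2[OF D(1,3,2), of m]
  note rot = normal_derivative_cpoly_rotation[OF D(1,2) w _ m]
  show "CGPT1 (contrast \<kappa>) D m n = 0" if "\<not> p dvd m + n"
    unfolding CGPT1_def
  proof (rule moment_NP_resolvent_eq_0[OF D(1,2) w f])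
    show "\<forall>x\<in>frontier D. ?f (w * x) = w ^ m * ?f x" using rot by blast
    show "w ^ n * w ^ m \<noteq> 1" using that unity[of "m + n"] by (simp add: power_add mult.commute)
  qed
  show "CGPT2 (contrast \<kappa>) D m n = 0" if nd: "\<not> int p dvd int m - int n"
    unfolding CGPT2_def normal_derivative_cnj_cpoly[abs_def]
  proof (rule moment_NP_resolvent_eq_0[OF D(1,2) w])
    show "(\<lambda>x. cnj (?f x)) \<in> L2 (arc_length D)"
      using f by (simp add: L2_def measurable_compose[OF _ borel_measurable_continuous_onI[OF continuous_on_cnj[OF continuous_on_id]]])
    show "\<forall>x\<in>frontier D. cnj (?f (w * x)) = cnj w ^ m * cnj (?f x)"
      by (simp add: rot)
    show "w ^ n * cnj w ^ m \<noteq> 1"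
    proof
      assume "w ^ n * cnj w ^ m = 1"
      then have "w ^ m = w ^ m * (w ^ n * cnj w ^ m)" by simp
      also have "\<dots> = w ^ n * (w * cnj w) ^ m" by (simp only: power_mult_distrib mult_ac)
      finally have eq: "w ^ m = w ^ n" using w(1) by simp
      have dvd: "p dvd k" if "w ^ (l + k) = w ^ l" for l k
      proof -
        have "w ^ l * w ^ k = w ^ l * 1" using that by (simp only: power_add mult_1_right)
        moreover have "w ^ l \<noteq> 0" using w(1) by auto
        ultimately show ?thesis using unity[of k] mult_cancel_left by blast
      qed
      have "int p dvd int m - int n"
      proof (cases "n \<le> m")
        case True
        then obtain k where k: "m = n + k" using le_Suc_ex by blast
        then show ?thesis using dvd[of n k] eq by simp
      next
        case False
        then obtain k where k: "n = m + k" using le_Suc_ex nat_le_linear by blast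
        then show ?thesis using dvd[of m k] eq by simp
      qed
      then show False using nd by simp
    qed
  qed
qed

end
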